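(* Let $X=\mathsf{X}_G$ be a tree-shift of finite type given as a vertex tree-shift with essential graph representation $G=G_0\sqcup G_1$, $n\times n$ adjacency matrices $A_0$ and $A_1$, and alphabet $\mathcal{A}$ (with $|\mathcal{A}|=n$). If there exist a word $w\in\Sigma^{n2^{n-1}}$ and $i,j\in\mathcal{A}$ such that $A_{w'}(i,j)=0$ for every nonempty prefix $w'$ of $w$, then $X$ is not irreducible.
   Context: Let $\Sigma=\{0,1\}$, let $\Sigma^k$ be the set of words of length $k$ over $\Sigma$ ($\Sigma^0=\{\epsilon\}$), $\Sigma^*=\bigcup_{k\ge 0}\Sigma^k$, and $\Sigma_k=\bigcup_{l=0}^k\Sigma^l$; $|x|$ is the length of a word $x$. A (infinite) tree over a finite alphabet $\mathcal{A}$ is a function $t:\Sigma^*\to\mathcal{A}$; write $t_x=t(x)$. A $k$-block ($k\ge 1$) is a function $u:\Sigma_{k-1}\to\mathcal{A}$, with support $S(u)=\Sigma_{k-1}$. For a tree $t$ and $x\in\Sigma^*$, $t|_{xS(u)}=u$ means $t_{xy}=u_y$ for all $y\in S(u)$ (and $t|_{S(u)}=u$ is the case $x=\epsilon$). For a set $X$ of trees, $B_k(X)$ is the set of all $k$-blocks $u$ with $t|_{xS(u)}=u$ for some $t\in X$, $x\in\Sigma^*$. Vertex tree-shift: $G_0,G_1$ are finite directed graphs, each with $n$ vertices and at most one edge from any vertex to any vertex, with ($0$-$1$) adjacency matrices $A_0,A_1$ indexed by $\mathcal{A}=\{0,\dots,n-1\}$; $G=G_0\sqcup G_1$ is the disjoint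 union, and $\mathsf{X}_G=\{t\in\mathcal{A}^{\Sigma^*}: A_0(t_x,t_{x0})=1 \text{ and } A_1(t_x,t_{x1})=1 \text{ for all } x\in\Sigma^*\}$. $G$ is essential: each of its vertices is the initial state of some edge and the terminal state of some edge (so no $A_i$ has a zero row or zero column). For $x=x_1x_2\cdots x_l\in\Sigma^*$ with $l\ge1$, $A_x=A_{x_1}A_{x_2}\cdots A_{x_l}$. A set $P\subset\Sigma^*$ is a prefix set if no word in $P$ is a prefix of another word in $P$. For finite $P$, $|P|=\max\{|x|:x\in P\}$. A finite prefix set $P$ is a complete prefix set (CPS) if every $x\in\Sigma^*$ with $|x|\ge|P|$ has a prefix in $P$ (a word counts as a prefix of itself). $X$ is irreducible if for every $k$ and every pair $u,v\in B_k(X)$ there are $t\in X$ and a CPS $P\subset\bigcup_{l\ge k}\Sigma^l$ such that $t|_{S(u)}=u$ and $t|_{xS(v)}=v$ for all $x\in P$. *)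

theory Defs
  imports
    "HOL-Library.FuncSet"
    "HOL-Library.Sublist"
    "Jordan_Normal_Form.Matrix"
    "Graph_Theory.Pair_Digraph"
begin

text \<open>Words over \<open>{0, 1}\<close> are Boolean lists, with \<open>False\<close> for the letter 0 and
  \<open>True\<close> for the letter 1.\<close>

type_synonym word = "bool list"

type_synonym 'a tree = "word \<Rightarrow> 'a"

definition words_upto :: "nat \<Rightarrow> word set"
  where "words_upto k = {x. length x \<le> k}"

definition trees :: "'a set \<Rightarrow> 'a tree set"
  where "trees \<A> = UNIV \<rightarrow> \<A>"

text \<open>A \<open>k\<close>-block (\<open>k \<ge> 1\<close>) is a function on the support \<open>words_upto (k - 1)\<close>; being a partial
  function, it is represented by an extensional one.\<close>

definition k_blocks :: "'a set \<Rightarrow> nat \<Rightarrow> (word \<Rightarrow> 'a) set"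
  where "k_blocks \<A> k = words_upto (k - 1) \<rightarrow>\<^sub>E \<A>"

definition occurs_at :: "nat \<Rightarrow> (word \<Rightarrow> 'a) \<Rightarrow> 'a tree \<Rightarrow> word \<Rightarrow> bool"
  where "occurs_at k u t x \<longleftrightarrow> (\<forall>y\<in>words_upto (k - 1). t (x @ y) = u y)"

definition blocks_of :: "'a set \<Rightarrow> nat \<Rightarrow> 'a tree set \<Rightarrow> (word \<Rightarrow> 'a) set"
  where "blocks_of \<A> k X = {u \<in> k_blocks \<A> k. \<exists>t\<in>X. \<exists>x. occurs_at k u t x}"

definition prefix_set :: "word set \<Rightarrow> bool"
  where "prefix_set P \<longleftrightarrow> (\<forall>x\<in>P. \<forall>y\<in>P. x \<noteq> y \<longrightarrow> \<not> prefix x y)"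

text \<open>The value of \<open>Max {}\<close> is irrelevant below: for every natural number there is a word of that
  length, and it has no prefix in \<open>{}\<close>, so the empty set is not complete.\<close>

definition complete_prefix_set :: "word set \<Rightarrow> bool"
  where "complete_prefix_set P \<longleftrightarrow> finite P \<and> prefix_set P \<and>
    (\<forall>x. length x \<ge> Max (length ` P) \<longrightarrow> (\<exists>p\<in>P. prefix p x))"

definition irreducible_shift :: "'a set \<Rightarrow> 'a tree set \<Rightarrow> bool"
  where "irreducible_shift \<A> X \<longleftrightarrow>
    (\<forall>k\<ge>1. \<forall>u\<in>blocks_of \<A> k X. \<forall>v\<in>blocks_of \<A> k X.
      \<exists>t\<in>X. \<exists>P. complete_prefix_set P \<and> P \<subseteq> {x. length x \<ge> k} \<and>
        occurs_at k u t [] \<and> (\<forall>x\<in>P. occurs_at k v t x))"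

definition adjacency_matrix :: "nat \<Rightarrow> nat pair_pre_digraph \<Rightarrow> nat mat"
  where "adjacency_matrix n G = mat n n (\<lambda>(i, j). if (i, j) \<in> parcs G then 1 else 0)"

definition disjoint_union_digraph ::
    "'a pair_pre_digraph \<Rightarrow> 'b pair_pre_digraph \<Rightarrow> ('a + 'b) pair_pre_digraph"
  where "disjoint_union_digraph G H =
    \<lparr>pverts = pverts G <+> pverts H,
     parcs = map_prod Inl Inl ` parcs G \<union> map_prod Inr Inr ` parcs H\<rparr>"

definition essential_digraph :: "'a pair_pre_digraph \<Rightarrow> bool"
  where "essential_digraph G \<longleftrightarrow>
    (\<forall>v\<in>pverts G. (\<exists>w. (v, w) \<in> parcs G) \<and> (\<exists>w. (w, v) \<in> parcs G))"

definition vertex_tree_shift :: "nat \<Rightarrow> nat mat \<Rightarrow> nat mat \<Rightarrow> nat tree set"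
  where "vertex_tree_shift n A0 A1 =
    {t \<in> trees {..<n}. \<forall>x. A0 $$ (t x, t (x @ [False])) = 1 \<and> A1 $$ (t x, t (x @ [True])) = 1}"

fun word_matrix :: "nat \<Rightarrow> nat mat \<Rightarrow> nat mat \<Rightarrow> word \<Rightarrow> nat mat"
  where
    "word_matrix n A0 A1 [] = 1\<^sub>m n"
  | "word_matrix n A0 A1 (b # x) = (if b then A1 else A0) * word_matrix n A0 A1 x"

end

theory Submission
  imports Defs
begin

text \<open>For each nonempty prefix of \<open>w\<close>, consider the set of states reachable from \<open>i\<close> along it.
  These sets are nonempty because the graphs are essential, and they miss \<open>j\<close>, so there are at
  most \<open>2 ^ (n - 1) - 1\<close> of them. By the pigeonhole principle two prefixes give the same set, and
  looping between the two occurrences yields arbitrarily long words along which \<open>j\<close> is never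
  reached from \<open>i\<close>. No tree with root \<open>i\<close> can then carry \<open>j\<close> on a complete prefix set.\<close>

definition reach :: "nat \<Rightarrow> nat mat \<Rightarrow> nat mat \<Rightarrow> nat \<Rightarrow> word \<Rightarrow> nat set"
  where "reach n A0 A1 i x = {l. l < n \<and> word_matrix n A0 A1 x $$ (i, l) \<noteq> 0}"

lemma word_matrix_carrier:
  assumes "A0 \<in> carrier_mat n n" and "A1 \<in> carrier_mat n n"
  shows "word_matrix n A0 A1 x \<in> carrier_mat n n"
  using assms by (induction x) auto

text \<open>The recursion peels letters off the front, whereas prefixes of a word grow at the
  end.\<close>

lemma word_matrix_snoc:
  assumes "A0 \<in> carrier_mat n n" and "A1 \<in> carrier_mat n n"
  shows "word_matrix n A0 A1 (x @ [b]) = word_matrix n A0 A1 x * (if b then A1 else A0)"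
proof (induction x)
  case Nil
  then show ?case using assms by simp
next
  case (Cons a x)
  then show ?case
    using assms word_matrix_carrier[OF assms, of x] by (simp add: assoc_mult_mat)
qed

lemma reach_Nil: "i < n \<Longrightarrow> reach n A0 A1 i [] = {i}"
  by (auto simp: reach_def split: if_splits)

text \<open>Entries are natural numbers, so nothing cancels: a sum of products is nonzero iff some
  summand has both factors nonzero. Hence the next set depends only on the current set and the
  letter read, which is what makes looping possible.\<close>

lemma reach_snoc:
  assumes "A0 \<in> carrier_mat n n" and "A1 \<in> carrier_mat n n" and "i < n"
  shows "reach n A0 A1 i (x @ [b]) =
    {l. l < n \<and> (\<exists>m\<in>reach n A0 A1 i x. (if b then A1 else A0) $$ (m, l) \<noteq> 0)}"
proof -
  let ?B = "if b then A1 else A0" and ?W = "word_matrix n A0 A1 x"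
  have carr: "?W \<in> carrier_mat n n" "?B \<in> carrier_mat n n"
    using word_matrix_carrier[OF assms(1,2)] assms(1,2) by auto
  have "(?W * ?B) $$ (i, l) \<noteq> 0 \<longleftrightarrow> (\<exists>m<n. ?W $$ (i, m) \<noteq> 0 \<and> ?B $$ (m, l) \<noteq> 0)"
    if "l < n" for l
  proof -
    have "(?W * ?B) $$ (i, l) = (\<Sum>m<n. ?W $$ (i, m) * ?B $$ (m, l))"
      using carr assms(3) that by (simp add: scalar_prod_def atLeast0LessThan)
    then show ?thesis by (simp only: sum_eq_0_iff finite_lessThan mult_eq_0_iff Ball_def lessThan_iff
          not_all not_imp de_Morgan_disj)
  qed
  then show ?thesis
    unfolding reach_def word_matrix_snoc[OF assms(1,2)] by blast
qed

lemma reach_nonempty: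
  assumes "A0 \<in> carrier_mat n n" and "A1 \<in> carrier_mat n n" and "i < n"
    and "\<And>b m. m < n \<Longrightarrow> \<exists>l<n. (if b then A1 else A0) $$ (m, l) \<noteq> 0"
  shows "reach n A0 A1 i x \<noteq> {}"
proof (induction x rule: rev_induct)
  case Nil
  then show ?case using assms(3) by (simp add: reach_Nil)
next
  case (snoc b x)
  then obtain m where m: "m \<in> reach n A0 A1 i x" by auto
  then have "m < n" by (simp add: reach_def)
  then obtain l where "l < n" "(if b then A1 else A0) $$ (m, l) \<noteq> 0"
    using assms(4) by blast
  with m show ?case unfolding reach_snoc[OF assms(1-3)] by blast
qed

lemma vertex_tree_shift_arc:
  "t \<in> vertex_tree_shift n A0 A1 \<Longrightarrow> (if b then A1 else A0) $$ (t x, t (x @ [b])) = 1"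
  by (cases b) (auto simp: vertex_tree_shift_def)

lemma vertex_tree_shift_less: "t \<in> vertex_tree_shift n A0 A1 \<Longrightarrow> t x < n"
  by (auto simp: vertex_tree_shift_def trees_def)

lemma vertex_tree_shift_reach:
  assumes "A0 \<in> carrier_mat n n" and "A1 \<in> carrier_mat n n"
    and t: "t \<in> vertex_tree_shift n A0 A1"
  shows "t x \<in> reach n A0 A1 (t []) x"
proof (induction x rule: rev_induct)
  case Nil
  then show ?case by (simp add: reach_Nil vertex_tree_shift_less[OF t])
next
  case (snoc b x)
  moreover have "(if b then A1 else A0) $$ (t x, t (x @ [b])) \<noteq> 0"
    using vertex_tree_shift_arc[OF t, of b x] by linarith
  ultimately show ?case
    unfolding reach_snoc[OF assms(1,2) vertex_tree_shift_less[OF t]]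
    using vertex_tree_shift_less[OF t] by blast
qed

text \<open>Fix one successor for each state and letter, then label every node by following these
  choices from the root.\<close>

lemma vertex_tree_shift_root_exists:
  assumes "i < n" and "\<And>b m. m < n \<Longrightarrow> \<exists>l<n. (if b then A1 else A0) $$ (m, l) = 1"
  shows "\<exists>t\<in>vertex_tree_shift n A0 A1. t [] = i"
proof -
  define s where "s b m = (SOME l. l < n \<and> (if b then A1 else A0) $$ (m, l) = 1)" for b m
  have s: "s b m < n \<and> (if b then A1 else A0) $$ (m, s b m) = 1" if "m < n" for b m
    unfolding s_def by (rule someI_ex) (rule assms(2)[OF that])
  \<comment> \<open>\<open>foldl\<close> reads a word from the root downwards, so appending a letter
    applies one more successor choice.\<close>
  define t where "t = foldl (\<lambda>m b. s b m) i"
  have t_snoc: "t (x @ [b]) = s b (t x)" for x b by (simp add: t_def)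
  have lt: "t x < n" for x
  proof (induction x rule: rev_induct)
    case Nil
    then show ?case using assms(1) by (simp add: t_def)
  next
    case (snoc b x)
    then show ?case unfolding t_snoc using s by blast
  qed
  have "A0 $$ (t x, t (x @ [False])) = 1" "A1 $$ (t x, t (x @ [True])) = 1" for x
    using s[OF lt, of False x] s[OF lt, of True x] by (simp_all add: t_snoc)
  then have "t \<in> vertex_tree_shift n A0 A1"
    using lt by (simp add: vertex_tree_shift_def trees_def)
  moreover have "t [] = i" by (simp add: t_def)
  ultimately show ?thesis by blast
qed

text \<open>This is irreducibility for 1-blocks: their support is just the empty word, so they
  amount to single labels. The bound \<open>length x \<ge> 1\<close> on \<open>P\<close> excludes
  the empty word.\<close>

lemma irreducible_shift_vertices:
  assumes irr: "irreducible_shift \<A> X"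
    and "t \<in> X" "t [] \<in> \<A>" and "t' \<in> X" "t' [] \<in> \<A>"
  shows "\<exists>r\<in>X. \<exists>P. complete_prefix_set P \<and> [] \<notin> P \<and> r [] = t [] \<and> (\<forall>x\<in>P. r x = t' [])"
proof -
  have blk: "restrict s (words_upto 0) \<in> blocks_of \<A> 1 X" if "s \<in> X" "s [] \<in> \<A>" for s
  proof -
    have "occurs_at 1 (restrict s (words_upto 0)) s []"
      by (simp add: occurs_at_def)
    moreover have "restrict s (words_upto 0) \<in> k_blocks \<A> 1"
      using that by (auto simp: k_blocks_def words_upto_def)
    ultimately show ?thesis using that by (auto simp: blocks_of_def)
  qed
  have occ: "occurs_at 1 (restrict s (words_upto 0)) r x \<longleftrightarrow> r x = s []" for s r x
    by (simp add: occurs_at_def words_upto_def)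
  obtain r P where "r \<in> X" "complete_prefix_set P" "P \<subseteq> {x. length x \<ge> 1}"
    "occurs_at 1 (restrict t (words_upto 0)) r []"
    "\<forall>x\<in>P. occurs_at 1 (restrict t' (words_upto 0)) r x"
    using irr[unfolded irreducible_shift_def, rule_format, OF le_refl
        blk[OF assms(2,3)] blk[OF assms(4,5)]] by blast
  moreover from this(3) have "[] \<notin> P" by auto
  ultimately show ?thesis unfolding occ by blast
qed

text \<open>No pumped word is written down. The sets met before the first repetition found form a
  family in which some letter always leads back into the family, so a word can be extended letter by
  letter to any length \<open>L\<close>.\<close>

lemma reach_avoiding_long_words:
  assumes A: "A0 \<in> carrier_mat n n" "A1 \<in> carrier_mat n n" and "i < n" and "j < n"
    and nz: "\<And>b m. m < n \<Longrightarrow> \<exists>l<n. (if b then A1 else A0) $$ (m, l) \<noteq> 0"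
    and len: "length w \<ge> 2 ^ (n - 1)"
    and avoid: "\<And>x. prefix x w \<Longrightarrow> x \<noteq> [] \<Longrightarrow> j \<notin> reach n A0 A1 i x"
  shows "\<exists>y. length y = L \<and> (\<forall>x. prefix x y \<and> x \<noteq> [] \<longrightarrow> j \<notin> reach n A0 A1 i x)"
proof -
  let ?R = "reach n A0 A1 i"
  let ?S = "\<lambda>m. ?R (take m w)"
  have j_notin: "j \<notin> ?S m" if "m \<in> {1..length w}" for m
    using avoid[OF take_is_prefix, of m] that by (cases w) auto
  have "?S ` {1..length w} \<subseteq> Pow ({..<n} - {j}) - {{}}"
    using reach_nonempty[OF A \<open>i < n\<close> nz] j_notin by (auto simp: reach_def)
  then have "card (?S ` {1..length w}) \<le> card (Pow ({..<n} - {j}) - {{}})"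
    by (intro card_mono) auto
  also have "\<dots> = 2 ^ (n - 1) - 1"
    using \<open>j < n\<close> by (simp add: card_Pow card_Diff_subset)
  also have "\<dots> < card {1..length w}"
    using len by (simp add: less_le_trans[OF diff_less])
  finally have "\<not> inj_on ?S {1..length w}" by (rule pigeonhole)
  then obtain a b where ab: "1 \<le> a" "a < b" "b \<le> length w" "?S a = ?S b"
    unfolding inj_on_def by (metis atLeastAtMost_iff linorder_neqE_nat)
  \<comment> \<open>Position 0 is left out because its set is \<open>{i}\<close>, which contains
    \<open>j\<close> when \<open>i = j\<close>; position \<open>b\<close> adds nothing, as its set
    equals that of \<open>a\<close>.\<close>
  let ?F = "?S ` {1..<b}"
  have take_Suc: "take (Suc m) w = take m w @ [w ! m]" if "m < b" for m
    using that ab by (simp add: take_Suc_conv_app_nth)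
  \<comment> \<open>At \<open>Suc m = b\<close> the walk jumps back to position \<open>a\<close>,
    which lies in the range since \<open>1 \<le> a < b\<close>.\<close>
  have SF: "?S (Suc m) \<in> ?F" if "m < b" for m
  proof (cases "Suc m = b")
    case True
    then show ?thesis using ab by (metis atLeastLessThan_iff image_eqI)
  next
    case False
    then show ?thesis using that by auto
  qed
  have step: "\<exists>c. ?R (y @ [c]) \<in> ?F" if y: "y = [] \<or> ?R y \<in> ?F" for y
  proof -
    \<comment> \<open>The empty word corresponds to \<open>m = 0\<close>, whose set need not belong
      to \<open>?F\<close>.\<close>
    obtain m where m: "m < b" "?R y = ?S m"
      using y ab by (cases "y = []") fastforce+
    have "?R (y @ [w ! m]) = ?S (Suc m)"
      unfolding take_Suc[OF m(1)] reach_snoc[OF A \<open>i < n\<close>] m(2) ..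
    with SF[OF m(1)] show ?thesis by metis
  qed
  have "\<exists>y. length y = L \<and> (\<forall>x. prefix x y \<and> x \<noteq> [] \<longrightarrow> ?R x \<in> ?F)"
  proof (induction L)
    case 0
    then show ?case by simp
  next
    case (Suc L)
    then obtain y where y: "length y = L" "\<And>x. prefix x y \<Longrightarrow> x \<noteq> [] \<Longrightarrow> ?R x \<in> ?F"
      by blast
    have "y = [] \<or> ?R y \<in> ?F" using y(2)[OF prefix_order.refl] by blast
    from step[OF this] obtain c where c: "?R (y @ [c]) \<in> ?F" ..
    have "?R x \<in> ?F" if "prefix x (y @ [c])" "x \<noteq> []" for x
      using that c y(2) unfolding prefix_snoc by metis
    with y(1) show ?case by (intro exI[of _ "y @ [c]"]) simp
  qed
  moreover have "j \<notin> T" if "T \<in> ?F" for T using that j_notin ab by auto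
  ultimately show ?thesis by blast
qed

text \<open>Arcs of the disjoint union stay within one copy, so an outgoing arc at
  \<open>Inl m\<close> comes from \<open>G0\<close> and one at \<open>Inr m\<close> from
  \<open>G1\<close>.\<close>

lemma essential_disjoint_union_arcs:
  assumes "pair_fin_digraph G0" and "pair_fin_digraph G1"
    and "pverts G0 = {..<n}" and "pverts G1 = {..<n}"
    and ess: "essential_digraph (disjoint_union_digraph G0 G1)" and "m < n"
  shows "\<exists>l<n. (if b then adjacency_matrix n G1 else adjacency_matrix n G0) $$ (m, l) = 1"
proof -
  interpret G0: pair_fin_digraph G0 by fact
  interpret G1: pair_fin_digraph G1 by fact
  have "Inl m \<in> pverts (disjoint_union_digraph G0 G1)"
    "Inr m \<in> pverts (disjoint_union_digraph G0 G1)"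
    using assms(3,4,6) by (auto simp: disjoint_union_digraph_def)
  then have "\<exists>l. (m, l) \<in> parcs G0" "\<exists>l. (m, l) \<in> parcs G1"
    using ess by (fastforce simp: essential_digraph_def disjoint_union_digraph_def)+
  moreover have "l < n" if "(m, l) \<in> parcs G0 \<or> (m, l) \<in> parcs G1" for l
    using that G0.in_arcsD2 G1.in_arcsD2 assms(3,4) by auto
  ultimately show ?thesis
    using \<open>m < n\<close> by (cases b) (fastforce simp: adjacency_matrix_def)+
qed

theorem theorem4p9:
  fixes n :: nat
    and G0 G1 :: "nat pair_pre_digraph"
    and A0 A1 :: "nat mat"
    and X :: "nat tree set"
  assumes "pair_fin_digraph G0" and "pair_fin_digraph G1"
    and "pverts G0 = {..<n}" and "pverts G1 = {..<n}"
    and "essential_digraph (disjoint_union_digraph G0 G1)"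
    and "A0 = adjacency_matrix n G0" and "A1 = adjacency_matrix n G1"
    and "X = vertex_tree_shift n A0 A1"
    and "\<exists>w :: word. length w = n * 2 ^ (n - 1) \<and>
      (\<exists>i\<in>{..<n}. \<exists>j\<in>{..<n}. \<forall>w'. prefix w' w \<and> w' \<noteq> [] \<longrightarrow>
        word_matrix n A0 A1 w' $$ (i, j) = 0)"
  shows "\<not> irreducible_shift {..<n} X"
proof
  assume irr: "irreducible_shift {..<n} X"
  have A: "A0 \<in> carrier_mat n n" "A1 \<in> carrier_mat n n"
    using assms(6,7) by (auto simp: adjacency_matrix_def)
  have arcs: "\<exists>l<n. (if b then A1 else A0) $$ (m, l) = 1" if "m < n" for b m
    unfolding assms(6,7) by (rule essential_disjoint_union_arcs[OF assms(1-5) that])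
  then have nz: "\<exists>l<n. (if b then A1 else A0) $$ (m, l) \<noteq> 0" if "m < n" for b m
    using that by (metis zero_neq_one)
  from assms(9) obtain w i j where w: "length w = n * 2 ^ (n - 1)" and ij: "i < n" "j < n"
    and avoid: "\<And>x. prefix x w \<Longrightarrow> x \<noteq> [] \<Longrightarrow> j \<notin> reach n A0 A1 i x"
    by (fastforce simp: reach_def)
  \<comment> \<open>Here \<open>i < n\<close> gives \<open>n \<ge> 1\<close>.\<close>
  have len: "length w \<ge> 2 ^ (n - 1)" using w ij by simp
  obtain t t' where t: "t \<in> X" "t [] = i" "t' \<in> X" "t' [] = j"
    using vertex_tree_shift_root_exists[of _ n A1 A0, OF _ arcs] ij assms(8) by metis
  then obtain r P where r: "r \<in> X" "r [] = i" and P: "complete_prefix_set P" "[] \<notin> P"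
    and rP: "\<And>x. x \<in> P \<Longrightarrow> r x = j"
    using irreducible_shift_vertices[OF irr t(1) _ t(3)] ij by auto
  \<comment> \<open>This is the length from which completeness guarantees a prefix in
    \<open>P\<close>.\<close>
  obtain y where y: "length y = Max (length ` P)"
    and y_avoid: "\<And>x. prefix x y \<Longrightarrow> x \<noteq> [] \<Longrightarrow> j \<notin> reach n A0 A1 i x"
    using reach_avoiding_long_words[OF A ij nz len avoid] by metis
  obtain p where p: "p \<in> P" "prefix p y"
    using P(1) y by (metis complete_prefix_set_def order_refl)
  have "r p \<in> reach n A0 A1 i p"
    using vertex_tree_shift_reach[OF A, of r p] r assms(8) by simp
  \<comment> \<open>Avoidance holds only for nonempty prefixes, so the case \<open>i = j\<close>
    with \<open>p\<close> empty must be ruled out.\<close>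
  moreover have "p \<noteq> []" using p P(2) by auto
  ultimately show False using rP y_avoid p by auto
qed

end
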